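(* Let $\leq$ be a partial entrenchment on the set $\mathcal{L}$ of propositional sentences. Then the maxiconsistent inference relation $\mid\!\sim_\leq$ satisfies all the rules of system $\mathbf{P}$: for all $\alpha,\beta,\gamma\in\mathcal{L}$, (Supraclassicality) if $\alpha\vdash\beta$ then $\alpha\mid\!\sim_\leq\beta$; (Left Logical Equivalence) if $\alpha\vdash\beta$, $\beta\vdash\alpha$ and $\alpha\mid\!\sim_\leq\gamma$, then $\beta\mid\!\sim_\leq\gamma$; (Right Weakening) if $\alpha\mid\!\sim_\leq\beta$ and $\beta\vdash\gamma$, then $\alpha\mid\!\sim_\leq\gamma$; (And) if $\alpha\mid\!\sim_\leq\beta$ and $\alpha\mid\!\sim_\leq\gamma$, then $\alpha\mid\!\sim_\leq\beta\land\gamma$; (Cut) if $\alpha\mid\!\sim_\leq\beta$ and $\alpha\land\beta\mid\!\sim_\leq\gamma$, then $\alpha\mid\!\sim_\leq\gamma$; (Cautious Monotonicity) if $\alpha\mid\!\sim_\leq\beta$ and $\alpha\mid\!\sim_\leq\gamma$, then $\alpha\land\beta\mid\!\sim_\leq\gamma$; (Or) if $\alpha\mid\!\sim_\leq\gamma$ and $\beta\mid\!\sim_\leq\gamma$, then $\alpha\lor\beta\mid\!\sim_\leq\gamma$.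
   Context: $\mathcal{L}$ is a propositional language over a set of atoms, closed under $\neg,\lor,\land,\to$; $\vdash$ is classical propositional consequence and $\mathrm{Cn}(X)$ the classical closure of a set $X$ ($\mathrm{Cn}(X,\alpha)=\mathrm{Cn}(X\cup\{\alpha\})$). A partial entrenchment is a binary relation $\leq$ on $\mathcal{L}$ such that: (Transitivity) $\alpha\leq\beta$ and $\beta\leq\gamma$ imply $\alpha\leq\gamma$; (Dominance) $\alpha\vdash\beta$ implies $\alpha\leq\beta$; (Conjunction) $\gamma\leq\alpha$ and $\gamma\leq\beta$ imply $\gamma\leq\alpha\land\beta$. A filter of $\leq$ is a proper subset $F\subsetneq\mathcal{L}$ that is upper-closed ($\alpha\in F$, $\alpha\leq\beta$ imply $\beta\in F$) and closed under conjunction. $\mathcal{F}$ denotes the set of filters. For $\alpha\in\mathcal{L}$: $\mathrm{Coh}(\alpha)=\{\beta:\beta\not\leq\neg\alpha\}$; $\mathcal{F}(\alpha)=\{F\in\mathcal{F}:F\subseteq\mathrm{Coh}(\alpha)\}$; $\mathcal{F}_{\max}(\alpha)$ is the set of $\subseteq$-maximal elements of $\mathcal{F}(\alpha)$; $e(\alpha)=\{\mathrm{Cn}(F,\alpha):F\in\mathcal{F}_{\max}(\alpha)\}$; $E(\alpha)=\bigcap e(\alpha)$ (with $\bigcap\emptyset=\mathcal{L}$). Maxiconsistent inference: $\alpha\mid\!\sim_\leq\beta$ iff $\beta\in E(\alpha)$. *)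

theory Defs
  imports Main
begin

datatype 'a form =
    Atom 'a
  | Neg "'a form"
  | Or "'a form" "'a form"
  | And "'a form" "'a form"
  | Imp "'a form" "'a form"

text \<open>Classical consequence is derivability in natural deduction; theorem \<open>adequacy\<close> below
  identifies it with truth preservation under all Boolean valuations.\<close>

inductive derives :: "'a form set \<Rightarrow> 'a form \<Rightarrow> bool" (infix \<open>\<turnstile>\<close> 50) where
  Assm:   "\<alpha> \<in> X \<Longrightarrow> X \<turnstile> \<alpha>"
| ImpI:   "insert \<alpha> X \<turnstile> \<beta> \<Longrightarrow> X \<turnstile> Imp \<alpha> \<beta>"
| ImpE:   "X \<turnstile> Imp \<alpha> \<beta> \<Longrightarrow> X \<turnstile> \<alpha> \<Longrightarrow> X \<turnstile> \<beta>"
| AndI:   "X \<turnstile> \<alpha> \<Longrightarrow> X \<turnstile> \<beta> \<Longrightarrow> X \<turnstile> And \<alpha> \<beta>"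
| AndE1:  "X \<turnstile> And \<alpha> \<beta> \<Longrightarrow> X \<turnstile> \<alpha>"
| AndE2:  "X \<turnstile> And \<alpha> \<beta> \<Longrightarrow> X \<turnstile> \<beta>"
| OrI1:   "X \<turnstile> \<alpha> \<Longrightarrow> X \<turnstile> Or \<alpha> \<beta>"
| OrI2:   "X \<turnstile> \<beta> \<Longrightarrow> X \<turnstile> Or \<alpha> \<beta>"
| OrE:    "X \<turnstile> Or \<alpha> \<beta> \<Longrightarrow> insert \<alpha> X \<turnstile> \<gamma> \<Longrightarrow> insert \<beta> X \<turnstile> \<gamma> \<Longrightarrow> X \<turnstile> \<gamma>"
| NegI:   "insert \<alpha> X \<turnstile> \<beta> \<Longrightarrow> insert \<alpha> X \<turnstile> Neg \<beta> \<Longrightarrow> X \<turnstile> Neg \<alpha>"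
| Reductio: "insert (Neg \<alpha>) X \<turnstile> \<beta> \<Longrightarrow> insert (Neg \<alpha>) X \<turnstile> Neg \<beta> \<Longrightarrow> X \<turnstile> \<alpha>"

definition Cn :: "'a form set \<Rightarrow> 'a form set" where
  "Cn X = {\<beta>. X \<turnstile> \<beta>}"

definition partial_entrenchment :: "('a form \<Rightarrow> 'a form \<Rightarrow> bool) \<Rightarrow> bool" where
  "partial_entrenchment le \<longleftrightarrow>
     (\<forall>\<alpha> \<beta> \<gamma>. le \<alpha> \<beta> \<longrightarrow> le \<beta> \<gamma> \<longrightarrow> le \<alpha> \<gamma>) \<and>
     (\<forall>\<alpha> \<beta>. {\<alpha>} \<turnstile> \<beta> \<longrightarrow> le \<alpha> \<beta>) \<and>
     (\<forall>\<alpha> \<beta> \<gamma>. le \<gamma> \<alpha> \<longrightarrow> le \<gamma> \<beta> \<longrightarrow> le \<gamma> (And \<alpha> \<beta>))"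

text \<open>Properness excludes only the whole language: the empty set is a filter.\<close>

definition is_filter :: "('a form \<Rightarrow> 'a form \<Rightarrow> bool) \<Rightarrow> 'a form set \<Rightarrow> bool" where
  "is_filter le F \<longleftrightarrow>
     F \<subset> UNIV \<and>
     (\<forall>\<alpha> \<beta>. \<alpha> \<in> F \<longrightarrow> le \<alpha> \<beta> \<longrightarrow> \<beta> \<in> F) \<and>
     (\<forall>\<alpha> \<beta>. \<alpha> \<in> F \<longrightarrow> \<beta> \<in> F \<longrightarrow> And \<alpha> \<beta> \<in> F)"

definition Coh :: "('a form \<Rightarrow> 'a form \<Rightarrow> bool) \<Rightarrow> 'a form \<Rightarrow> 'a form set" where
  "Coh le \<alpha> = {\<beta>. \<not> le \<beta> (Neg \<alpha>)}"

definition filters_in_Coh :: "('a form \<Rightarrow> 'a form \<Rightarrow> bool) \<Rightarrow> 'a form \<Rightarrow> 'a form set set" where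
  "filters_in_Coh le \<alpha> = {F. is_filter le F \<and> F \<subseteq> Coh le \<alpha>}"

definition max_filters :: "('a form \<Rightarrow> 'a form \<Rightarrow> bool) \<Rightarrow> 'a form \<Rightarrow> 'a form set set" where
  "max_filters le \<alpha> =
     {F \<in> filters_in_Coh le \<alpha>. \<forall>G \<in> filters_in_Coh le \<alpha>. F \<subseteq> G \<longrightarrow> G = F}"

definition extensions :: "('a form \<Rightarrow> 'a form \<Rightarrow> bool) \<Rightarrow> 'a form \<Rightarrow> 'a form set set" where
  "extensions le \<alpha> = {Cn (F \<union> {\<alpha>}) | F. F \<in> max_filters le \<alpha>}"

definition E :: "('a form \<Rightarrow> 'a form \<Rightarrow> bool) \<Rightarrow> 'a form \<Rightarrow> 'a form set" where
  "E le \<alpha> = \<Inter> (extensions le \<alpha>)"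

definition maxiconsistent_inference ::
    "('a form \<Rightarrow> 'a form \<Rightarrow> bool) \<Rightarrow> 'a form \<Rightarrow> 'a form \<Rightarrow> bool" where
  "maxiconsistent_inference le \<alpha> \<beta> \<longleftrightarrow> \<beta> \<in> E le \<alpha>"

primrec sat :: "('a \<Rightarrow> bool) \<Rightarrow> 'a form \<Rightarrow> bool" where
  "sat v (Atom a) \<longleftrightarrow> v a"
| "sat v (Neg \<alpha>) \<longleftrightarrow> \<not> sat v \<alpha>"
| "sat v (Or \<alpha> \<beta>) \<longleftrightarrow> sat v \<alpha> \<or> sat v \<beta>"
| "sat v (And \<alpha> \<beta>) \<longleftrightarrow> sat v \<alpha> \<and> sat v \<beta>"
| "sat v (Imp \<alpha> \<beta>) \<longleftrightarrow> (sat v \<alpha> \<longrightarrow> sat v \<beta>)"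

lemma soundness: "X \<turnstile> \<alpha> \<Longrightarrow> (\<And>\<beta>. \<beta> \<in> X \<Longrightarrow> sat v \<beta>) \<Longrightarrow> sat v \<alpha>"
proof (induction rule: derives.induct)
  case (OrE X \<alpha> \<beta> \<gamma>)
  then show ?case by (metis insert_iff sat.simps(3))
next
  case (NegI \<alpha> X \<beta>)
  then show ?case by (metis insert_iff sat.simps(2))
next
  case (Reductio \<alpha> X \<beta>)
  then show ?case by (metis insert_iff sat.simps(2))
next
  case (ImpI \<alpha> X \<beta>)
  then show ?case by (metis insert_iff sat.simps(5))
qed simp_all

lemma weakening: "X \<turnstile> \<alpha> \<Longrightarrow> X \<subseteq> Y \<Longrightarrow> Y \<turnstile> \<alpha>"
proof (induction arbitrary: Y rule: derives.induct)
  case (Assm \<alpha> X) then show ?case by (blast intro: derives.Assm)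
next
  case (ImpI \<alpha> X \<beta>) then show ?case by (meson derives.ImpI insert_mono)
next
  case (ImpE X \<alpha> \<beta>) then show ?case by (meson derives.ImpE)
next
  case (AndI X \<alpha> \<beta>) then show ?case by (meson derives.AndI)
next
  case (AndE1 X \<alpha> \<beta>) then show ?case by (meson derives.AndE1)
next
  case (AndE2 X \<alpha> \<beta>) then show ?case by (meson derives.AndE2)
next
  case (OrI1 X \<alpha> \<beta>) then show ?case by (meson derives.OrI1)
next
  case (OrI2 X \<beta> \<alpha>) then show ?case by (meson derives.OrI2)
next
  case (OrE X \<alpha> \<beta> \<gamma>) then show ?case by (meson derives.OrE insert_mono)
next
  case (NegI \<alpha> X \<beta>) then show ?case by (meson derives.NegI insert_mono)
next
  case (Reductio \<alpha> X \<beta>) then show ?case by (meson derives.Reductio insert_mono)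
qed

lemma finite_support: "X \<turnstile> \<alpha> \<Longrightarrow> \<exists>Y. finite Y \<and> Y \<subseteq> X \<and> Y \<turnstile> \<alpha>"
proof (induction rule: derives.induct)
  case (Assm \<alpha> X)
  then show ?case by (intro exI[of _ "{\<alpha>}"]) (auto intro: derives.Assm)
next
  case (ImpI \<alpha> X \<beta>)
  then obtain Y where *: "finite Y" "Y \<subseteq> insert \<alpha> X" "Y \<turnstile> \<beta>" by blast
  have "insert \<alpha> (Y - {\<alpha>}) \<turnstile> \<beta>" using *(3) by (rule weakening) auto
  then have "Y - {\<alpha>} \<turnstile> Imp \<alpha> \<beta>" by (rule derives.ImpI)
  with * show ?case by (intro exI[of _ "Y - {\<alpha>}"]) auto
next
  case (ImpE X \<alpha> \<beta>)
  then obtain Y Z where "finite (Y \<union> Z)" "Y \<union> Z \<subseteq> X" "Y \<turnstile> Imp \<alpha> \<beta>" "Z \<turnstile> \<alpha>" by auto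
  then show ?case by (meson derives.ImpE weakening Un_upper1 Un_upper2)
next
  case (AndI X \<alpha> \<beta>)
  then obtain Y Z where "finite (Y \<union> Z)" "Y \<union> Z \<subseteq> X" "Y \<turnstile> \<alpha>" "Z \<turnstile> \<beta>" by auto
  then show ?case by (meson derives.AndI weakening Un_upper1 Un_upper2)
next
  case (AndE1 X \<alpha> \<beta>) then show ?case by (meson derives.AndE1)
next
  case (AndE2 X \<alpha> \<beta>) then show ?case by (meson derives.AndE2)
next
  case (OrI1 X \<alpha> \<beta>) then show ?case by (meson derives.OrI1)
next
  case (OrI2 X \<beta> \<alpha>) then show ?case by (meson derives.OrI2)
next
  case (OrE X \<alpha> \<beta> \<gamma>)
  then obtain U Y Z where *: "finite U" "finite Y" "finite Z" "U \<subseteq> X" "Y \<subseteq> insert \<alpha> X"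
    "Z \<subseteq> insert \<beta> X" "U \<turnstile> Or \<alpha> \<beta>" "Y \<turnstile> \<gamma>" "Z \<turnstile> \<gamma>" by metis
  let ?W = "U \<union> (Y - {\<alpha>}) \<union> (Z - {\<beta>})"
  have "?W \<turnstile> Or \<alpha> \<beta>" using *(7) by (rule weakening) auto
  moreover have "insert \<alpha> ?W \<turnstile> \<gamma>" using *(8) by (rule weakening) auto
  moreover have "insert \<beta> ?W \<turnstile> \<gamma>" using *(9) by (rule weakening) auto
  ultimately have "?W \<turnstile> \<gamma>" by (rule derives.OrE)
  with * show ?case by (intro exI[of _ ?W]) auto
next
  case (NegI \<alpha> X \<beta>)
  then obtain Y Z where *: "finite Y" "finite Z" "Y \<subseteq> insert \<alpha> X" "Z \<subseteq> insert \<alpha> X"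
    "Y \<turnstile> \<beta>" "Z \<turnstile> Neg \<beta>" by metis
  let ?W = "(Y - {\<alpha>}) \<union> (Z - {\<alpha>})"
  have "insert \<alpha> ?W \<turnstile> \<beta>" using *(5) by (rule weakening) auto
  moreover have "insert \<alpha> ?W \<turnstile> Neg \<beta>" using *(6) by (rule weakening) auto
  ultimately have "?W \<turnstile> Neg \<alpha>" by (rule derives.NegI)
  with * show ?case by (intro exI[of _ ?W]) auto
next
  case (Reductio \<alpha> X \<beta>)
  then obtain Y Z where *: "finite Y" "finite Z" "Y \<subseteq> insert (Neg \<alpha>) X"
    "Z \<subseteq> insert (Neg \<alpha>) X" "Y \<turnstile> \<beta>" "Z \<turnstile> Neg \<beta>" by metis
  let ?W = "(Y - {Neg \<alpha>}) \<union> (Z - {Neg \<alpha>})"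
  have "insert (Neg \<alpha>) ?W \<turnstile> \<beta>" using *(5) by (rule weakening) auto
  moreover have "insert (Neg \<alpha>) ?W \<turnstile> Neg \<beta>" using *(6) by (rule weakening) auto
  ultimately have "?W \<turnstile> \<alpha>" by (rule derives.Reductio)
  with * show ?case by (intro exI[of _ ?W]) auto
qed

lemma explosion: "X \<turnstile> \<beta> \<Longrightarrow> X \<turnstile> Neg \<beta> \<Longrightarrow> X \<turnstile> \<alpha>"
  by (rule derives.Reductio[of _ _ \<beta>]) (blast intro: weakening)+

lemma case_split:
  assumes "insert \<beta> X \<turnstile> \<alpha>" "insert (Neg \<beta>) X \<turnstile> \<alpha>"
  shows "X \<turnstile> \<alpha>"
proof -
  let ?Y = "insert (Neg \<alpha>) X"
  have n: "insert \<delta> ?Y \<turnstile> Neg \<alpha>" for \<delta> by (rule derives.Assm) simp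
  have "insert \<beta> ?Y \<turnstile> \<alpha>" using assms(1) by (rule weakening) auto
  then have "?Y \<turnstile> Neg \<beta>" using n by (rule derives.NegI)
  moreover have "insert (Neg \<beta>) ?Y \<turnstile> \<alpha>" using assms(2) by (rule weakening) auto
  then have "?Y \<turnstile> \<beta>" using n by (rule derives.Reductio)
  ultimately show ?thesis using derives.Reductio by blast
qed

lemma lindenbaum:
  assumes "\<not> X \<turnstile> \<alpha>"
  obtains M where "X \<subseteq> M" "\<not> M \<turnstile> \<alpha>" "\<And>\<beta>. \<beta> \<notin> M \<Longrightarrow> insert \<beta> M \<turnstile> \<alpha>"
proof -
  let ?A = "{M. X \<subseteq> M \<and> \<not> M \<turnstile> \<alpha>}"
  have "\<exists>M\<in>?A. \<forall>N\<in>?A. M \<subseteq> N \<longrightarrow> N = M"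
  proof (rule subset_Zorn_nonempty)
    show "?A \<noteq> {}" using assms by auto
  next
    fix C assume C: "C \<noteq> {}" "subset.chain ?A C"
    have "\<not> \<Union>C \<turnstile> \<alpha>"
    proof
      assume "\<Union>C \<turnstile> \<alpha>"
      then obtain Y where Y: "finite Y" "Y \<subseteq> \<Union>C" "Y \<turnstile> \<alpha>" using finite_support by blast
      then obtain B where "B \<in> C" "Y \<subseteq> B"
        using finite_subset_Union_chain[OF Y(1,2) C] by blast
      with C(2) Y(3) show False unfolding subset.chain_def by (blast intro: weakening)
    qed
    with C show "\<Union>C \<in> ?A" unfolding subset.chain_def by blast
  qed
  then obtain M where M: "M \<in> ?A" "\<forall>N\<in>?A. M \<subseteq> N \<longrightarrow> N = M" by (rule bexE)
  show thesis
  proof (rule that)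
    show "X \<subseteq> M" "\<not> M \<turnstile> \<alpha>" using M(1) by auto
  next
    fix \<beta> assume "\<beta> \<notin> M"
    then have "insert \<beta> M \<notin> ?A" using M(2) by (metis insertI1 subset_insertI)
    then show "insert \<beta> M \<turnstile> \<alpha>" using M(1) by auto
  qed
qed

lemma completeness:
  assumes "\<And>v. (\<forall>\<beta>\<in>X. sat v \<beta>) \<Longrightarrow> sat v \<alpha>"
  shows "X \<turnstile> \<alpha>"
proof (rule ccontr)
  assume "\<not> X \<turnstile> \<alpha>"
  then obtain M where M: "X \<subseteq> M" "\<not> M \<turnstile> \<alpha>" "\<And>\<beta>. \<beta> \<notin> M \<Longrightarrow> insert \<beta> M \<turnstile> \<alpha>"
    by (rule lindenbaum) blast
  have mem: "\<beta> \<in> M \<longleftrightarrow> M \<turnstile> \<beta>" for \<beta>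
    using Assm M(2,3) ImpE[of M \<beta> \<alpha>] ImpI[of \<beta> M \<alpha>] by blast
  have neg: "M \<turnstile> Neg \<beta> \<longleftrightarrow> \<not> M \<turnstile> \<beta>" for \<beta>
    using M(2) mem case_split[of \<beta> M \<alpha>] M(3) explosion[of M \<beta> \<alpha>] by blast
  have disj: "M \<turnstile> Or \<beta> \<gamma> \<longleftrightarrow> M \<turnstile> \<beta> \<or> M \<turnstile> \<gamma>" for \<beta> \<gamma>
    using M(2,3) mem OrE[of M \<beta> \<gamma> \<alpha>] OrI1[of M \<beta> \<gamma>] OrI2[of M \<gamma> \<beta>] by blast
  have conj: "M \<turnstile> And \<beta> \<gamma> \<longleftrightarrow> M \<turnstile> \<beta> \<and> M \<turnstile> \<gamma>" for \<beta> \<gamma>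
    using AndI[of M \<beta> \<gamma>] AndE1[of M \<beta> \<gamma>] AndE2[of M \<beta> \<gamma>] by blast
  have imp: "M \<turnstile> Imp \<beta> \<gamma> \<longleftrightarrow> (M \<turnstile> \<beta> \<longrightarrow> M \<turnstile> \<gamma>)" for \<beta> \<gamma>
  proof
    assume "M \<turnstile> \<beta> \<longrightarrow> M \<turnstile> \<gamma>"
    then consider "M \<turnstile> \<gamma>" | "M \<turnstile> Neg \<beta>" using neg by blast
    then show "M \<turnstile> Imp \<beta> \<gamma>"
    proof cases
      case 1
      then show ?thesis by (meson ImpI weakening subset_insertI)
    next
      case 2
      then have "insert \<beta> M \<turnstile> Neg \<beta>" by (meson weakening subset_insertI)
      then show ?thesis by (meson ImpI explosion Assm insertI1)
    qed
  qed (meson ImpE)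
  have "sat (\<lambda>a. M \<turnstile> Atom a) \<beta> \<longleftrightarrow> M \<turnstile> \<beta>" for \<beta>
    by (induction \<beta>) (simp_all add: neg disj conj imp)
  with assms[of "\<lambda>a. M \<turnstile> Atom a"] M(1,2) mem show False by blast
qed

theorem adequacy: "X \<turnstile> \<alpha> \<longleftrightarrow> (\<forall>v. (\<forall>\<beta>\<in>X. sat v \<beta>) \<longrightarrow> sat v \<alpha>)"
  using soundness[of X \<alpha>] completeness[of X \<alpha>] by blast

end

theory Submission
  imports Defs
begin

text \<open>A filter lies in \<open>Coh le \<alpha>\<close> iff it omits \<open>Neg \<alpha>\<close>. Hence, if \<open>{\<alpha>} \<turnstile> \<beta>\<close>, a maximal filter \<open>F\<close>
  for \<open>\<beta>\<close> either contains \<open>Neg \<alpha>\<close>, and then \<open>insert \<alpha> F\<close> is inconsistent, or is already maximal for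
  \<open>\<alpha>\<close>; in both cases \<open>insert \<alpha> F\<close> derives everything that \<open>\<alpha>\<close> infers. This gives Left Logical
  Equivalence, Cut and Or. For Cautious Monotonicity, enlarge a maximal filter for \<open>And \<alpha> \<beta>\<close> to a
  maximal filter \<open>G\<close> for \<open>\<alpha>\<close> by Zorn's lemma: as \<open>insert \<alpha> G \<turnstile> \<beta>\<close> and nonempty filters are
  deductively closed, \<open>G\<close> still omits \<open>Neg (And \<alpha> \<beta>)\<close>, so nothing was added.\<close>

lemma partial_entrenchment_dominance:
  "partial_entrenchment le \<Longrightarrow> {\<alpha>} \<turnstile> \<beta> \<Longrightarrow> le \<alpha> \<beta>"
  unfolding partial_entrenchment_def by blast

lemma is_filter_up: "is_filter le F \<Longrightarrow> \<alpha> \<in> F \<Longrightarrow> le \<alpha> \<beta> \<Longrightarrow> \<beta> \<in> F"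
  unfolding is_filter_def by blast

lemma is_filter_And: "is_filter le F \<Longrightarrow> \<alpha> \<in> F \<Longrightarrow> \<beta> \<in> F \<Longrightarrow> And \<alpha> \<beta> \<in> F"
  unfolding is_filter_def by blast

text \<open>The witness is the conjunction of \<open>Y\<close> built onto an arbitrary member of
  \<open>F\<close>; nonemptiness supplies that member when \<open>Y\<close> is empty.\<close>

lemma filter_finite_conjunction:
  assumes "is_filter le F" "F \<noteq> {}" "finite Y" "Y \<subseteq> F"
  shows "\<exists>\<delta>\<in>F. \<forall>v. sat v \<delta> \<longrightarrow> (\<forall>\<beta>\<in>Y. sat v \<beta>)"
  using assms(3,4)
proof (induction rule: finite_induct)
  case empty
  then show ?case using assms(2) by auto
next
  case (insert \<beta> Y)
  then obtain \<delta> where "\<delta> \<in> F" "\<forall>v. sat v \<delta> \<longrightarrow> (\<forall>\<beta>\<in>Y. sat v \<beta>)" by auto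
  then show ?case
    using insert.prems is_filter_And[OF assms(1), of \<beta> \<delta>] by (intro bexI[of _ "And \<beta> \<delta>"]) auto
qed

text \<open>By finite support, finitely many premises suffice; a single member of \<open>F\<close>
  entails them all, and Dominance puts it below \<open>\<beta>\<close>. The empty filter is excluded
  because it derives tautologies without containing them.\<close>

lemma nonempty_filter_derives:
  assumes "partial_entrenchment le" "is_filter le F" "F \<noteq> {}" "F \<turnstile> \<beta>"
  shows "\<beta> \<in> F"
proof -
  obtain Y where Y: "finite Y" "Y \<subseteq> F" "Y \<turnstile> \<beta>"
    using assms(4) finite_support by blast
  obtain \<delta> where \<delta>: "\<delta> \<in> F" "\<forall>v. sat v \<delta> \<longrightarrow> (\<forall>\<beta>\<in>Y. sat v \<beta>)"
    using filter_finite_conjunction[OF assms(2,3) Y(1,2)] by blast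
  have "{\<delta>} \<turnstile> \<beta>" using Y(3) \<delta>(2) by (auto simp: adequacy)
  then show ?thesis
    using is_filter_up[OF assms(2) \<delta>(1)] partial_entrenchment_dominance[OF assms(1)] by blast
qed

text \<open>A member below \<open>Neg \<alpha>\<close> would bring \<open>Neg \<alpha>\<close> into
  the filter by upward closure; conversely, \<open>Neg \<alpha>\<close> is below itself by
  Dominance.\<close>

lemma filters_in_Coh_iff:
  assumes "partial_entrenchment le"
  shows "F \<in> filters_in_Coh le \<alpha> \<longleftrightarrow> is_filter le F \<and> Neg \<alpha> \<notin> F"
  using partial_entrenchment_dominance[OF assms, of "Neg \<alpha>" "Neg \<alpha>"] is_filter_up[of le F]
  unfolding filters_in_Coh_def Coh_def by (blast intro: derives.Assm)

text \<open>Contraposition: \<open>Neg \<beta>\<close> is below \<open>Neg \<alpha>\<close>, so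
  omitting the latter forces omitting the former.\<close>

lemma filters_in_Coh_mono:
  assumes "partial_entrenchment le" "{\<alpha>} \<turnstile> \<beta>"
  shows "filters_in_Coh le \<alpha> \<subseteq> filters_in_Coh le \<beta>"
proof -
  have "{Neg \<beta>} \<turnstile> Neg \<alpha>" using assms(2) by (auto simp: adequacy)
  then have "le (Neg \<beta>) (Neg \<alpha>)" by (rule partial_entrenchment_dominance[OF assms(1)])
  then show ?thesis
    by (auto simp: filters_in_Coh_iff[OF assms(1)] intro: is_filter_up)
qed

text \<open>Maximality is inherited because the competitors for \<open>\<alpha>\<close> are among
  those for \<open>\<beta>\<close>.\<close>

lemma max_filters_restrict:
  assumes "partial_entrenchment le" "{\<alpha>} \<turnstile> \<beta>"
    and "F \<in> max_filters le \<beta>" "F \<in> filters_in_Coh le \<alpha>"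
  shows "F \<in> max_filters le \<alpha>"
  using assms(3,4) filters_in_Coh_mono[OF assms(1,2)] unfolding max_filters_def by blast

lemma max_filters_extend:
  assumes "partial_entrenchment le" "F \<in> filters_in_Coh le \<alpha>"
  obtains G where "G \<in> max_filters le \<alpha>" "F \<subseteq> G"
proof -
  let ?A = "{G \<in> filters_in_Coh le \<alpha>. F \<subseteq> G}"
  have "\<exists>M\<in>?A. \<forall>N\<in>?A. M \<subseteq> N \<longrightarrow> N = M"
  proof (rule subset_Zorn_nonempty)
    show "?A \<noteq> {}" using assms(2) by auto
  next
    fix C assume C: "C \<noteq> {}" "subset.chain ?A C"
    have mem: "is_filter le G" "Neg \<alpha> \<notin> G" "F \<subseteq> G" if "G \<in> C" for G
      using C(2) that unfolding subset.chain_def by (auto simp: filters_in_Coh_iff[OF assms(1)])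
    have "And \<beta> \<gamma> \<in> \<Union>C" if \<beta>\<gamma>: "\<beta> \<in> \<Union>C" "\<gamma> \<in> \<Union>C" for \<beta> \<gamma>
    proof -
      \<comment> \<open>Both conjuncts already lie in one member of the chain, which is closed under
        conjunction.\<close>
      have "{\<beta>, \<gamma>} \<subseteq> \<Union>C" using \<beta>\<gamma> by blast
      then obtain G where G: "G \<in> C" "{\<beta>, \<gamma>} \<subseteq> G"
        using finite_subset_Union_chain[OF _ _ C, of "{\<beta>, \<gamma>}"] by blast
      then show ?thesis using is_filter_And[OF mem(1)[OF G(1)]] by blast
    qed
    moreover have "\<gamma> \<in> \<Union>C" if "\<beta> \<in> \<Union>C" "le \<beta> \<gamma>" for \<beta> \<gamma>
      using that is_filter_up[OF mem(1)] by blast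
    \<comment> \<open>This also makes the union a proper subset of the language.\<close>
    moreover have "Neg \<alpha> \<notin> \<Union>C" using mem(2) by blast
    ultimately have "\<Union>C \<in> filters_in_Coh le \<alpha>"
      unfolding filters_in_Coh_iff[OF assms(1)] is_filter_def by blast
    then show "\<Union>C \<in> ?A" using C(1) mem(3) by blast
  qed
  then obtain M where "M \<in> ?A" "\<forall>N\<in>?A. M \<subseteq> N \<longrightarrow> N = M" by (rule bexE)
  then show thesis
    by (intro that[of M]) (auto simp: max_filters_def)
qed

lemma maxiconsistent_inference_iff:
  "maxiconsistent_inference le \<alpha> \<beta> \<longleftrightarrow> (\<forall>F\<in>max_filters le \<alpha>. insert \<alpha> F \<turnstile> \<beta>)"
  unfolding maxiconsistent_inference_def E_def extensions_def Cn_def by auto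

lemma filters_in_Coh_And:
  assumes "partial_entrenchment le" "F \<in> filters_in_Coh le \<alpha>" "insert \<alpha> F \<turnstile> \<beta>"
  shows "F \<in> filters_in_Coh le (And \<alpha> \<beta>)"
proof -
  have F: "is_filter le F" "Neg \<alpha> \<notin> F"
    using assms(2) by (auto simp: filters_in_Coh_iff[OF assms(1)])
  have "Neg (And \<alpha> \<beta>) \<notin> F"
  proof
    assume *: "Neg (And \<alpha> \<beta>) \<in> F"
    \<comment> \<open>A valuation satisfying \<open>F\<close> and \<open>\<alpha>\<close> would
      satisfy \<open>\<beta>\<close>, against \<open>Neg (And \<alpha> \<beta>)\<close>. That same
      formula witnesses that \<open>F\<close> is nonempty, hence deductively closed.\<close>
    have "F \<turnstile> Neg \<alpha>" using assms(3) * by (fastforce simp: adequacy)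
    then show False using nonempty_filter_derives[OF assms(1) F(1)] * F(2) by blast
  qed
  then show ?thesis using F(1) by (simp add: filters_in_Coh_iff[OF assms(1)])
qed

text \<open>Carries what a stronger premise infers over to the maximal filters of a weaker one, by
  the dichotomy on \<open>Neg \<alpha>\<close>.\<close>

lemma max_filters_derives_mono:
  assumes "partial_entrenchment le" "F \<in> max_filters le \<beta>" "{\<alpha>} \<turnstile> \<beta>"
    and "maxiconsistent_inference le \<alpha> \<gamma>"
  shows "insert \<alpha> F \<turnstile> \<gamma>"
proof (cases "Neg \<alpha> \<in> F")
  case True
  then show ?thesis by (fastforce simp: adequacy)
next
  case False
  then have "F \<in> filters_in_Coh le \<alpha>"
    using assms(2) by (simp add: max_filters_def filters_in_Coh_iff[OF assms(1)])
  then show ?thesis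
    using max_filters_restrict[OF assms(1,3,2)] assms(4)
    by (simp add: maxiconsistent_inference_iff)
qed

theorem theorem1:
  fixes le :: "'a form \<Rightarrow> 'a form \<Rightarrow> bool"
  assumes "partial_entrenchment le"
  shows
    "(\<forall>\<alpha> \<beta>. {\<alpha>} \<turnstile> \<beta> \<longrightarrow> maxiconsistent_inference le \<alpha> \<beta>) \<and>
     (\<forall>\<alpha> \<beta> \<gamma>. {\<alpha>} \<turnstile> \<beta> \<longrightarrow> {\<beta>} \<turnstile> \<alpha> \<longrightarrow> maxiconsistent_inference le \<alpha> \<gamma> \<longrightarrow>
        maxiconsistent_inference le \<beta> \<gamma>) \<and>
     (\<forall>\<alpha> \<beta> \<gamma>. maxiconsistent_inference le \<alpha> \<beta> \<longrightarrow> {\<beta>} \<turnstile> \<gamma> \<longrightarrow>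
        maxiconsistent_inference le \<alpha> \<gamma>) \<and>
     (\<forall>\<alpha> \<beta> \<gamma>. maxiconsistent_inference le \<alpha> \<beta> \<longrightarrow> maxiconsistent_inference le \<alpha> \<gamma> \<longrightarrow>
        maxiconsistent_inference le \<alpha> (And \<beta> \<gamma>)) \<and>
     (\<forall>\<alpha> \<beta> \<gamma>. maxiconsistent_inference le \<alpha> \<beta> \<longrightarrow> maxiconsistent_inference le (And \<alpha> \<beta>) \<gamma> \<longrightarrow>
        maxiconsistent_inference le \<alpha> \<gamma>) \<and>
     (\<forall>\<alpha> \<beta> \<gamma>. maxiconsistent_inference le \<alpha> \<beta> \<longrightarrow> maxiconsistent_inference le \<alpha> \<gamma> \<longrightarrow>
        maxiconsistent_inference le (And \<alpha> \<beta>) \<gamma>) \<and>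
     (\<forall>\<alpha> \<beta> \<gamma>. maxiconsistent_inference le \<alpha> \<gamma> \<longrightarrow> maxiconsistent_inference le \<beta> \<gamma> \<longrightarrow>
        maxiconsistent_inference le (Or \<alpha> \<beta>) \<gamma>)"
proof (intro conjI allI impI)
  fix \<alpha> \<beta> :: "'a form"
  assume "{\<alpha>} \<turnstile> \<beta>"
  then show "maxiconsistent_inference le \<alpha> \<beta>"
    by (auto simp: maxiconsistent_inference_iff intro: weakening)
next
  fix \<alpha> \<beta> \<gamma> :: "'a form"
  assume eq: "{\<alpha>} \<turnstile> \<beta>" "{\<beta>} \<turnstile> \<alpha>" and \<gamma>: "maxiconsistent_inference le \<alpha> \<gamma>"
  show "maxiconsistent_inference le \<beta> \<gamma>"
    unfolding maxiconsistent_inference_iff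
  proof
    fix F assume "F \<in> max_filters le \<beta>"
    then have "insert \<alpha> F \<turnstile> \<gamma>" using max_filters_derives_mono[OF assms _ eq(1) \<gamma>] by blast
    then show "insert \<beta> F \<turnstile> \<gamma>" using eq(2) by (auto simp: adequacy)
  qed
next
  fix \<alpha> \<beta> \<gamma> :: "'a form"
  assume "maxiconsistent_inference le \<alpha> \<beta>" "{\<beta>} \<turnstile> \<gamma>"
  then show "maxiconsistent_inference le \<alpha> \<gamma>"
    by (auto simp: maxiconsistent_inference_iff adequacy)
next
  fix \<alpha> \<beta> \<gamma> :: "'a form"
  assume "maxiconsistent_inference le \<alpha> \<beta>" "maxiconsistent_inference le \<alpha> \<gamma>"
  then show "maxiconsistent_inference le \<alpha> (And \<beta> \<gamma>)"
    by (auto simp: maxiconsistent_inference_iff intro: derives.AndI)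
next
  fix \<alpha> \<beta> \<gamma> :: "'a form"
  assume \<beta>: "maxiconsistent_inference le \<alpha> \<beta>" and \<gamma>: "maxiconsistent_inference le (And \<alpha> \<beta>) \<gamma>"
  show "maxiconsistent_inference le \<alpha> \<gamma>"
    unfolding maxiconsistent_inference_iff
  proof
    fix F assume F: "F \<in> max_filters le \<alpha>"
    have F\<beta>: "insert \<alpha> F \<turnstile> \<beta>" using \<beta> F by (simp add: maxiconsistent_inference_iff)
    have "{And \<alpha> \<beta>} \<turnstile> \<alpha>" by (simp add: adequacy)
    \<comment> \<open>Here \<open>And \<alpha> \<beta>\<close> is the stronger premise and
      \<open>F\<close> is maximal for the weaker \<open>\<alpha>\<close>; \<open>F\<beta>\<close>
      then removes the conjunct \<open>\<beta>\<close>.\<close>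
    then have "insert (And \<alpha> \<beta>) F \<turnstile> \<gamma>"
      using max_filters_derives_mono[OF assms F _ \<gamma>] by blast
    with F\<beta> show "insert \<alpha> F \<turnstile> \<gamma>" by (auto simp: adequacy)
  qed
next
  fix \<alpha> \<beta> \<gamma> :: "'a form"
  assume \<beta>: "maxiconsistent_inference le \<alpha> \<beta>" and \<gamma>: "maxiconsistent_inference le \<alpha> \<gamma>"
  show "maxiconsistent_inference le (And \<alpha> \<beta>) \<gamma>"
    unfolding maxiconsistent_inference_iff
  proof
    fix F assume F: "F \<in> max_filters le (And \<alpha> \<beta>)"
    have "{And \<alpha> \<beta>} \<turnstile> \<alpha>" by (simp add: adequacy)
    \<comment> \<open>A priori \<open>F\<close> is maximal only among the filters omitting
      \<open>Neg (And \<alpha> \<beta>)\<close>, so a larger filter might still omit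
      \<open>Neg \<alpha>\<close>.\<close>
    then have "F \<in> filters_in_Coh le \<alpha>"
      using F filters_in_Coh_mono[OF assms] unfolding max_filters_def by blast
    then obtain G where G: "G \<in> max_filters le \<alpha>" "F \<subseteq> G"
      by (rule max_filters_extend[OF assms])
    have "insert \<alpha> G \<turnstile> \<beta>" using \<beta> G(1) by (simp add: maxiconsistent_inference_iff)
    \<comment> \<open>Thus \<open>G\<close> competes with \<open>F\<close>, and maximality of
      \<open>F\<close> forces equality.\<close>
    then have "G \<in> filters_in_Coh le (And \<alpha> \<beta>)"
      using filters_in_Coh_And[OF assms] G(1) by (simp add: max_filters_def)
    then have "G = F" using F G(2) by (simp add: max_filters_def)
    then have "insert \<alpha> F \<turnstile> \<gamma>" using \<gamma> G(1) by (simp add: maxiconsistent_inference_iff)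
    then show "insert (And \<alpha> \<beta>) F \<turnstile> \<gamma>" by (auto simp: adequacy)
  qed
next
  fix \<alpha> \<beta> \<gamma> :: "'a form"
  assume \<alpha>: "maxiconsistent_inference le \<alpha> \<gamma>" and \<beta>: "maxiconsistent_inference le \<beta> \<gamma>"
  show "maxiconsistent_inference le (Or \<alpha> \<beta>) \<gamma>"
    unfolding maxiconsistent_inference_iff
  proof
    fix F assume F: "F \<in> max_filters le (Or \<alpha> \<beta>)"
    \<comment> \<open>Each disjunct is a stronger premise than the disjunction, so both inferences
      transfer to the same \<open>F\<close> and combine by cases.\<close>
    have "{\<alpha>} \<turnstile> Or \<alpha> \<beta>" "{\<beta>} \<turnstile> Or \<alpha> \<beta>" by (simp_all add: adequacy)
    then have "insert \<alpha> F \<turnstile> \<gamma>" "insert \<beta> F \<turnstile> \<gamma>"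
      using max_filters_derives_mono[OF assms F] \<alpha> \<beta> by blast+
    then show "insert (Or \<alpha> \<beta>) F \<turnstile> \<gamma>" by (auto simp: adequacy)
  qed
qed

end
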